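(* Under the null hypothesis $\mathcal{H}_0: F=F_0$, on a suitable probability space carrying the sample sequence together with a sequence of Brownian bridges $\{\mathbb{B}_n:n\in\mathbb{N}^*\}$ such that, for some positive universal constants $A,B,C$, for all large enough $x$ and all $n\in\mathbb{N}^*$, $$\mathbb{P}\left\{\sup_{t\in\mathbb{R}}\left|\overline{\alpha}_n(t)-F(t)\,\mathbb{B}_n(F(t))\right|\geq\frac{1}{\sqrt{n}}\,(A\log n+x)\right\}\leq B\,e^{-Cx},$$ we have, with probability $1$, as $n\to\infty$, $$\left|\overline{\mathbf{S}}_n-\sup_{t\in\mathbb{R}}\left|F(t)\,\mathbb{B}_n(F(t))\right|\right|=O\left(\frac{\log n}{\sqrt{n}}\right),$$ $$\left|\overline{\mathbf{T}}_n-\int_{\mathbb{R}}\left[F(t)\,\mathbb{B}_n(F(t))\right]^2dF_0(t)\right|=O\left(\sqrt{\frac{\log\log n}{n}}\,\log n\right).$$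
   Context: $\mathbb{N}^*=\{1,2,\dots\}$. $\{X_i:i\in\mathbb{N}^*\}$ is a sequence of i.i.d. real random variables with continuous distribution function $F$; $F_0$ is a given continuous distribution function. For $n\in\mathbb{N}^*$ and $t\in\mathbb{R}$: $\mathbb{F}_n(t)=\frac1n\sum_{i=1}^n\mathbf{1}_{\{X_i\leq t\}}$, $\overline{\mathbb{F}}_n(t)=\int_{-\infty}^t\mathbb{F}_n(s)\,d\mathbb{F}_n(s)$ (i.e. $\frac1n\sum_{j=1}^n\mathbb{F}_n(X_j)\mathbf{1}_{\{X_j\leq t\}}$), $\overline{F}(t)=\frac12F(t)^2$, $\overline{F}_0(t)=\frac12F_0(t)^2$, and $\overline{\alpha}_n(t)=\sqrt{n}\,(\overline{\mathbb{F}}_n(t)-\overline{F}(t))$. The integrated Kolmogorov-Smirnov and Cramér-von Mises statistics are $$\overline{\mathbf{S}}_n=\sup_{t\in\mathbb{R}}\left|\sqrt{n}\left(\overline{\mathbb{F}}_n(t)-\overline{F}_0(t)\right)\right|,\qquad\overline{\mathbf{T}}_n=n\int_{\mathbb{R}}\left(\overline{\mathbb{F}}_n(t)-\overline{F}_0(t)\right)^2dF_0(t).$$ A Brownian bridge is a centered Gaussian process $\{\mathbb{B}(u):u\in[0,1]\}$ with continuous sample paths and covariance $\mathbb{E}(\mathbb{B}(u)\mathbb{B}(v))=u\wedge v-uv$. "On a suitable probability space" means that the probability space is rich enough that an independent sequence of Wiener processes, independent of the originally given i.i.d. sequence, can be constructed on it; such bridges $\mathbb{B}_n$ exist on such a space.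 *)

theory Defs
  imports "HOL-Probability.Probability" "HOL-Library.Landau_Symbols"
begin

text \<open>
  Samples are sequences \<open>X :: nat \<Rightarrow> 'a \<Rightarrow> real\<close> of which only the indices
  \<open>i \<ge> 1\<close> are meaningful.
\<close>

definition continuous_df :: "(real \<Rightarrow> real) \<Rightarrow> bool" where
  "continuous_df F \<longleftrightarrow> continuous_on UNIV F \<and> mono F \<and>
     (F \<longlongrightarrow> 0) at_bot \<and> (F \<longlongrightarrow> 1) at_top"

definition iid_with_df ::
    "'a measure \<Rightarrow> (nat \<Rightarrow> 'a \<Rightarrow> real) \<Rightarrow> (real \<Rightarrow> real) \<Rightarrow> bool" where
  "iid_with_df M X F \<longleftrightarrow>
     prob_space.indep_vars M (\<lambda>_. borel) X {1..} \<and>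
     (\<forall>i\<ge>1. cdf (distr M borel (X i)) = F)"

definition empirical_df :: "(nat \<Rightarrow> 'a \<Rightarrow> real) \<Rightarrow> nat \<Rightarrow> 'a \<Rightarrow> real \<Rightarrow> real" where
  "empirical_df X n \<omega> t = (1 / real n) * (\<Sum>i=1..n. indicator {..t} (X i \<omega>))"

text \<open>
  The Stieltjes integral of the empirical distribution function over the half-line up to \<open>t\<close>,
  taken against itself, i.e. against the measure with mass \<open>1 / n\<close> at each
  observation (with multiplicity).
\<close>

definition int_empirical_df :: "(nat \<Rightarrow> 'a \<Rightarrow> real) \<Rightarrow> nat \<Rightarrow> 'a \<Rightarrow> real \<Rightarrow> real" where
  "int_empirical_df X n \<omega> t =
     (1 / real n) * (\<Sum>j=1..n. empirical_df X n \<omega> (X j \<omega>) * indicator {..t} (X j \<omega>))"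

definition int_df :: "(real \<Rightarrow> real) \<Rightarrow> real \<Rightarrow> real" where
  "int_df F t = (1 / 2) * (F t)\<^sup>2"

definition int_empirical_process ::
    "(nat \<Rightarrow> 'a \<Rightarrow> real) \<Rightarrow> (real \<Rightarrow> real) \<Rightarrow> nat \<Rightarrow> 'a \<Rightarrow> real \<Rightarrow> real" where
  "int_empirical_process X F n \<omega> t =
     sqrt (real n) * (int_empirical_df X n \<omega> t - int_df F t)"

definition int_KS_stat ::
    "(nat \<Rightarrow> 'a \<Rightarrow> real) \<Rightarrow> (real \<Rightarrow> real) \<Rightarrow> nat \<Rightarrow> 'a \<Rightarrow> real" where
  "int_KS_stat X F0 n \<omega> =
     (SUP t. \<bar>sqrt (real n) * (int_empirical_df X n \<omega> t - int_df F0 t)\<bar>)"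

definition int_CvM_stat ::
    "(nat \<Rightarrow> 'a \<Rightarrow> real) \<Rightarrow> (real \<Rightarrow> real) \<Rightarrow> nat \<Rightarrow> 'a \<Rightarrow> real" where
  "int_CvM_stat X F0 n \<omega> =
     real n * (LINT t|interval_measure F0. (int_empirical_df X n \<omega> t - int_df F0 t)\<^sup>2)"

text \<open>
  Normal random variables, including the degenerate (constant) ones, which have no density.
\<close>

definition gaussian_rv :: "'a measure \<Rightarrow> ('a \<Rightarrow> real) \<Rightarrow> bool" where
  "gaussian_rv M Y \<longleftrightarrow> Y \<in> borel_measurable M \<and>
     ((\<exists>\<mu> \<sigma>. \<sigma> > 0 \<and> distributed M lborel Y (normal_density \<mu> \<sigma>)) \<or>
      (\<exists>\<mu>. AE \<omega> in M. Y \<omega> = \<mu>))"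

text \<open>
  A process is Gaussian if all finite linear combinations of its values are normal.  In
  particular the moments below exist as genuine integrals.
\<close>

definition centered_gaussian_process ::
    "'a measure \<Rightarrow> real set \<Rightarrow> (real \<Rightarrow> real \<Rightarrow> real) \<Rightarrow> (real \<Rightarrow> 'a \<Rightarrow> real) \<Rightarrow> bool" where
  "centered_gaussian_process M T K Z \<longleftrightarrow>
     (\<forall>S c. finite S \<and> S \<subseteq> T \<longrightarrow> gaussian_rv M (\<lambda>\<omega>. \<Sum>u\<in>S. c u * Z u \<omega>)) \<and>
     (\<forall>u\<in>T. (LINT \<omega>|M. Z u \<omega>) = 0) \<and>
     (\<forall>u\<in>T. \<forall>v\<in>T. (LINT \<omega>|M. Z u \<omega> * Z v \<omega>) = K u v)"

definition brownian_bridge :: "'a measure \<Rightarrow> (real \<Rightarrow> 'a \<Rightarrow> real) \<Rightarrow> bool" where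
  "brownian_bridge M B \<longleftrightarrow>
     centered_gaussian_process M {0..1} (\<lambda>u v. min u v - u * v) B \<and>
     (\<forall>\<omega>\<in>space M. continuous_on {0..1} (\<lambda>u. B u \<omega>))"

definition wiener_process :: "'a measure \<Rightarrow> (real \<Rightarrow> 'a \<Rightarrow> real) \<Rightarrow> bool" where
  "wiener_process M W \<longleftrightarrow>
     centered_gaussian_process M {0..} min W \<and>
     (\<forall>\<omega>\<in>space M. continuous_on {0..} (\<lambda>t. W t \<omega>))"

text \<open>
  The space carries a sequence of independent Wiener processes that is, as a whole, independent
  of the sample.  Processes are regarded as random elements of product spaces.
\<close>

definition suitable_space :: "'a measure \<Rightarrow> (nat \<Rightarrow> 'a \<Rightarrow> real) \<Rightarrow> bool" where
  "suitable_space M X \<longleftrightarrow>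
     (\<exists>W :: nat \<Rightarrow> real \<Rightarrow> 'a \<Rightarrow> real.
        (\<forall>k\<ge>1. wiener_process M (W k)) \<and>
        prob_space.indep_vars M (\<lambda>_. Pi\<^sub>M {0..} (\<lambda>_. borel))
          (\<lambda>k \<omega>. \<lambda>t\<in>{0..}. W k t \<omega>) {1..} \<and>
        prob_space.indep_set M
          (sets (vimage_algebra (space M)
             (\<lambda>\<omega>. \<lambda>i\<in>{1..}. X i \<omega>) (Pi\<^sub>M {1..} (\<lambda>_. borel))))
          (sets (vimage_algebra (space M)
             (\<lambda>\<omega>. \<lambda>(k, t)\<in>{1..} \<times> {0..}. W k t \<omega>)
             (Pi\<^sub>M ({1..} \<times> {0..}) (\<lambda>_. borel)))))"

text \<open>
  The exponential inequality for the approximation of the integrated empirical process by the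
  bridges \<open>BB n\<close>.  The threshold for \<open>x\<close> does not depend on \<open>n\<close>.
\<close>

definition bridge_approximation ::
    "'a measure \<Rightarrow> (nat \<Rightarrow> 'a \<Rightarrow> real) \<Rightarrow> (real \<Rightarrow> real) \<Rightarrow>
     (nat \<Rightarrow> real \<Rightarrow> 'a \<Rightarrow> real) \<Rightarrow> real \<Rightarrow> real \<Rightarrow> real \<Rightarrow> bool" where
  "bridge_approximation M X F BB A B C \<longleftrightarrow>
     (\<forall>\<^sub>F x in at_top. \<forall>n\<ge>1.
        \<P>(\<omega> in M. (SUP t. \<bar>int_empirical_process X F n \<omega> t - F t * BB n (F t) \<omega>\<bar>)
                    \<ge> (1 / sqrt (real n)) * (A * ln (real n) + x))
          \<le> B * exp (- C * x))"

end

(*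
  Let D_n be the supremum distance between the integrated empirical process and the process
  F B_n(F).  By Borel-Cantelli the exponential inequality gives D_n = O(log n / sqrt n) almost
  surely, which settles the Kolmogorov-Smirnov statistic.  For the Cramer-von Mises statistic,
  |int a^2 - int b^2| <= D_n (2 int |a| + D_n), so only a bounded law of the iterated logarithm
  for the L1(F)-norm of the integrated empirical process a is needed.  In the absence of ties,
  which have probability 0, the integrated empirical distribution function is (E^2 + E/n) / 2
  with E the empirical one, and this reduces the claim to the centered sums
  S_n(t) = sum_i (1{X_i <= t} - F(t)).

  For the L1-norm of S_n no chaining in t is required: by convexity exp(c int |S_n|) is at most
  int (exp(c S_n) + exp(-c S_n)), and for each t the expectation of the integrand is bounded by
  Hoeffding's lemma.  As exp(c S_n(t)) is a submartingale, the same bound holds for the maximum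
  over k <= n, and Borel-Cantelli along dyadic blocks yields the iterated logarithm.
*)
theory Submission
  imports Defs "HOL-Real_Asymp.Real_Asymp"
begin

section \<open>Exponential moments and an iterated logarithm for centered sums\<close>

text \<open>Convexity: the graph of \<open>exp\<close> lies above its tangent at \<open>x\<close>.
  This replaces conditional expectations in the submartingale argument and Jensen's inequality in
  the integral over \<open>t\<close>.\<close>

lemma exp_ge_tangent:
  fixes x y :: real
  shows "exp x * (1 + (y - x)) \<le> exp y"
proof -
  have "exp x * (1 + (y - x)) \<le> exp x * exp (y - x)"
    by (intro mult_left_mono exp_ge_add_one_self) auto
  then show ?thesis
    by (simp add: exp_add[symmetric])
qed

text \<open>Abstracts the centered indicators \<open>indicator {..t} x - F t\<close>. Joint
  measurability of \<open>g\<close> lets Fubini's theorem exchange the expectation with the integral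
  over \<open>t\<close>.\<close>

locale mean_zero_kernel = prob_space M + \<nu>: prob_space \<nu>
  for M :: "'a measure" and \<nu> :: "real measure" +
  fixes X :: "nat \<Rightarrow> 'a \<Rightarrow> real" and g :: "real \<Rightarrow> real \<Rightarrow> real"
  assumes sets_\<nu> [measurable_cong]: "sets \<nu> = sets borel"
    and indep: "indep_vars (\<lambda>_. borel) X {1..}"
    and g_measurable [measurable]: "case_prod g \<in> borel_measurable (borel \<Otimes>\<^sub>M borel)"
    and g_bounded: "\<bar>g t x\<bar> \<le> 1"
    and g_centered: "i \<ge> 1 \<Longrightarrow> expectation (\<lambda>\<omega>. g t (X i \<omega>)) = 0"
begin

definition S :: "nat \<Rightarrow> real \<Rightarrow> 'a \<Rightarrow> real" where
  "S n t \<omega> = (\<Sum>i=1..n. g t (X i \<omega>))"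

lemma X_measurable [measurable]: "i \<ge> 1 \<Longrightarrow> X i \<in> borel_measurable M"
  using indep by (auto simp: indep_vars_def)

lemma S_measurable_pair [measurable]:
  "(\<lambda>(\<omega>, t). S n t \<omega>) \<in> borel_measurable (M \<Otimes>\<^sub>M \<nu>)"
  unfolding S_def case_prod_beta by (intro borel_measurable_sum) measurable

lemma S_measurable [measurable]: "S n t \<in> borel_measurable M"
  unfolding S_def[abs_def] by (intro borel_measurable_sum) measurable

lemma S_measurable_param [measurable]: "(\<lambda>t. S n t \<omega>) \<in> borel_measurable \<nu>"
  unfolding S_def by (intro borel_measurable_sum) measurable

lemma S_bounded: "\<bar>S n t \<omega>\<bar> \<le> real n"
proof -
  have "\<bar>S n t \<omega>\<bar> \<le> (\<Sum>i=1..n. \<bar>g t (X i \<omega>)\<bar>)"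
    unfolding S_def by (rule sum_abs)
  also have "\<dots> \<le> (\<Sum>i=1..n. 1)"
    by (intro sum_mono g_bounded)
  finally show ?thesis by simp
qed

lemma mult_S_bounded: "c * S n t \<omega> \<le> \<bar>c\<bar> * real n"
proof -
  have "c * S n t \<omega> \<le> \<bar>c\<bar> * \<bar>S n t \<omega>\<bar>"
    by (metis abs_ge_self abs_mult)
  also have "\<dots> \<le> \<bar>c\<bar> * real n"
    by (intro mult_left_mono S_bounded) auto
  finally show ?thesis .
qed

lemma integrable_exp_S: "integrable M (\<lambda>\<omega>. exp (c * S n t \<omega>))"
  by (rule integrable_const_bound[of _ "exp (\<bar>c\<bar> * real n)"]) (auto simp: mult_S_bounded)

lemma integrable_abs_S: "integrable \<nu> (\<lambda>t. \<bar>S n t \<omega>\<bar>)"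
  by (rule \<nu>.integrable_const_bound[of _ "real n"]) (auto simp: S_bounded)

lemma expectation_exp_g_le:
  assumes "i \<ge> 1"
  shows "expectation (\<lambda>\<omega>. exp (c * g t (X i \<omega>))) \<le> exp (c\<^sup>2 / 2)"
proof -
  have [measurable]: "X i \<in> borel_measurable M"
    using assms by simp
  \<comment> \<open>Hoeffding's lemma for a positive parameter: the range [-1, 1] has length 2, and
    l^2 * 2^2 / 8 = l^2 / 2. Leaving \<open>f\<close> general allows the case \<open>c < 0\<close>
    to be reduced to \<open>- g\<close>.\<close>
  have le: "expectation (\<lambda>\<omega>. exp (l * f \<omega>)) \<le> exp (l\<^sup>2 / 2)"
    if "l > 0" and [measurable]: "f \<in> borel_measurable M"
      and "\<And>\<omega>. \<bar>f \<omega>\<bar> \<le> 1" "expectation f = 0"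
    for l :: real and f :: "'a \<Rightarrow> real"
  proof -
    interpret f: interval_bounded_random_variable M f "-1" 1
      by unfold_locales (use that(3) in \<open>auto simp: abs_le_iff minus_le_iff\<close>)
    have "integrable M (\<lambda>\<omega>. exp (l * f \<omega>))"
    proof (rule integrable_const_bound[of _ "exp l"])
      have "l * f \<omega> \<le> l * 1" for \<omega>
        by (intro mult_left_mono) (use that in \<open>auto simp: abs_le_iff\<close>)
      then show "AE \<omega> in M. norm (exp (l * f \<omega>)) \<le> exp l"
        by simp
    qed measurable
    then have "ennreal (expectation (\<lambda>\<omega>. exp (l * f \<omega>))) = (\<integral>\<^sup>+\<omega>. exp (l * f \<omega>) \<partial>M)"
      by (intro nn_integral_eq_integral[symmetric]) auto
    also have "\<dots> \<le> ennreal (exp (l\<^sup>2 * (1 - (-1))\<^sup>2 / 8))"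
      using that by (intro f.Hoeffdings_lemma_nn_integral_0)
    finally show ?thesis
      by (simp add: power2_eq_square)
  qed
  consider "c > 0" | "c = 0" | "c < 0" by linarith
  then show ?thesis
  proof cases
    case 1
    then show ?thesis
      by (intro le g_centered assms g_bounded) measurable
  next
    case 2
    then show ?thesis by (simp add: prob_space)
  next
    case 3
    have "expectation (\<lambda>\<omega>. exp ((- c) * (- g t (X i \<omega>)))) \<le> exp ((- c)\<^sup>2 / 2)"
      by (rule le) (use 3 g_bounded g_centered assms in auto)
    then show ?thesis by simp
  qed
qed

lemma integrable_exp_g:
  assumes "i \<ge> 1"
  shows "integrable M (\<lambda>\<omega>. exp (c * g t (X i \<omega>)))"
proof (rule integrable_const_bound[of _ "exp \<bar>c\<bar>"])
  have [measurable]: "X i \<in> borel_measurable M"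
    using assms by simp
  show "(\<lambda>\<omega>. exp (c * g t (X i \<omega>))) \<in> borel_measurable M"
    by measurable
  have "c * g t x \<le> \<bar>c\<bar>" for x
    using mult_left_mono[OF g_bounded[of t x], of "\<bar>c\<bar>"] abs_ge_self[of "c * g t x"]
    by (simp add: abs_mult)
  then show "AE \<omega> in M. norm (exp (c * g t (X i \<omega>))) \<le> exp \<bar>c\<bar>"
    by simp
qed

text \<open>Independence factorises the moment generating function, and Hoeffding's lemma bounds
  each of the \<open>n\<close> factors.\<close>

lemma expectation_exp_S_le: "expectation (\<lambda>\<omega>. exp (c * S n t \<omega>)) \<le> exp (real n * c\<^sup>2 / 2)"
proof -
  have ind: "indep_vars (\<lambda>_. borel) (\<lambda>i \<omega>. exp (c * g t (X i \<omega>))) {1..n}"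
    by (rule indep_vars_compose2[OF indep_vars_subset[OF indep]]) auto
  have "expectation (\<lambda>\<omega>. exp (c * S n t \<omega>)) = expectation (\<lambda>\<omega>. \<Prod>i=1..n. exp (c * g t (X i \<omega>)))"
    by (simp add: S_def sum_distrib_left exp_sum)
  also have "\<dots> = (\<Prod>i=1..n. expectation (\<lambda>\<omega>. exp (c * g t (X i \<omega>))))"
    by (rule indep_vars_lebesgue_integral[OF _ ind]) (auto intro: integrable_exp_g)
  also have "\<dots> \<le> (\<Prod>i=1..n. exp (c\<^sup>2 / 2))"
    by (intro prod_mono) (auto intro!: expectation_exp_g_le)
  also have "\<dots> = exp (real n * c\<^sup>2 / 2)"
    by (simp add: exp_of_nat_mult[symmetric])
  finally show ?thesis .
qed

text \<open>The submartingale property of \<open>exp (c * S n t)\<close>, tested on events of the past.\<close>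

lemma expectation_indicator_exp_S_mono:
  assumes "k \<le> n"
    and P [measurable]: "Measurable.pred (Pi\<^sub>M {1..k} (\<lambda>_. borel)) P"
  defines "A \<equiv> {\<omega> \<in> space M. P (\<lambda>i\<in>{1..k}. X i \<omega>)}"
  shows "expectation (\<lambda>\<omega>. indicator A \<omega> * exp (c * S k t \<omega>))
    \<le> expectation (\<lambda>\<omega>. indicator A \<omega> * exp (c * S n t \<omega>))"
proof -
  have [measurable]: "A \<in> sets M"
    unfolding A_def by measurable
  let ?u = "\<lambda>\<omega>. indicator A \<omega> * exp (c * S k t \<omega>)"
  \<comment> \<open>The weighted exponential as a function of the vector of the first
    \<open>k\<close> samples, the form in which independence of disjoint blocks of samples
    applies.\<close>
  define h where "h = (\<lambda>x. indicator {x. P x} x * exp (c * (\<Sum>i=1..k. g t (x i))))"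
  have h_meas [measurable]: "h \<in> borel_measurable (Pi\<^sub>M {1..k} (\<lambda>_. borel))"
    unfolding h_def by measurable
  have u_eq: "?u \<omega> = h (\<lambda>i\<in>{1..k}. X i \<omega>)" if "\<omega> \<in> space M" for \<omega>
    using that by (auto simp: h_def A_def S_def indicator_def)
  have int_u: "integrable M ?u"
    by (rule integrable_const_bound[of _ "exp (\<bar>c\<bar> * real k)"])
      (auto simp: mult_S_bounded indicator_def)
  \<comment> \<open>Each later increment has mean zero and is independent of the past, hence is
    orthogonal to \<open>?u\<close>.\<close>
  have prod0: "expectation (\<lambda>\<omega>. ?u \<omega> * g t (X i \<omega>)) = 0"
    and int_prod: "integrable M (\<lambda>\<omega>. ?u \<omega> * g t (X i \<omega>))" if "i \<in> {k<..n}" for i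
  proof -
    have [measurable]: "X i \<in> borel_measurable M"
      using that by simp
    have "indep_var (Pi\<^sub>M {1..k} (\<lambda>_. borel)) (\<lambda>\<omega>. \<lambda>i\<in>{1..k}. X i \<omega>)
        (Pi\<^sub>M {i} (\<lambda>_. borel)) (\<lambda>\<omega>. \<lambda>i\<in>{i}. X i \<omega>)"
      using that by (intro indep_var_restrict[OF indep]) auto
    then have "indep_var borel (h \<circ> (\<lambda>\<omega>. \<lambda>i\<in>{1..k}. X i \<omega>))
        borel ((\<lambda>x. g t (x i)) \<circ> (\<lambda>\<omega>. \<lambda>i\<in>{i}. X i \<omega>))"
      by (rule indep_var_compose) measurable
    then have ind: "indep_var borel (\<lambda>\<omega>. h (\<lambda>i\<in>{1..k}. X i \<omega>)) borel (\<lambda>\<omega>. g t (X i \<omega>))"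
      by (simp add: comp_def)
    have int1: "integrable M (\<lambda>\<omega>. h (\<lambda>i\<in>{1..k}. X i \<omega>))"
      using int_u by (subst (asm) Bochner_Integration.integrable_cong[OF refl u_eq]) auto
    have int2: "integrable M (\<lambda>\<omega>. g t (X i \<omega>))"
      by (rule integrable_const_bound[of _ 1]) (use g_bounded in auto)
    have "expectation (\<lambda>\<omega>. ?u \<omega> * g t (X i \<omega>))
        = expectation (\<lambda>\<omega>. h (\<lambda>i\<in>{1..k}. X i \<omega>) * g t (X i \<omega>))"
      by (rule Bochner_Integration.integral_cong) (simp_all add: u_eq)
    also have "\<dots> = expectation (\<lambda>\<omega>. h (\<lambda>i\<in>{1..k}. X i \<omega>)) * expectation (\<lambda>\<omega>. g t (X i \<omega>))"
      by (rule indep_var_lebesgue_integral[OF ind int1 int2])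
    finally show "expectation (\<lambda>\<omega>. ?u \<omega> * g t (X i \<omega>)) = 0"
      using that g_centered by simp
    show "integrable M (\<lambda>\<omega>. ?u \<omega> * g t (X i \<omega>))"
      using indep_var_integrable[OF ind int1 int2]
      by (subst Bochner_Integration.integrable_cong[OF refl]) (auto simp: u_eq)
  qed
  have S_split: "S n t \<omega> = S k t \<omega> + (\<Sum>i\<in>{k<..n}. g t (X i \<omega>))" for \<omega>
  proof -
    have "{1..n} = {1..k} \<union> {k<..n}" "{1..k} \<inter> {k<..n} = {}"
      using \<open>k \<le> n\<close> by auto
    then show ?thesis
      unfolding S_def by (metis sum.union_disjoint finite_atLeastAtMost finite_greaterThanAtMost)
  qed
  have sum0: "expectation (\<lambda>\<omega>. \<Sum>i\<in>{k<..n}. ?u \<omega> * g t (X i \<omega>)) = 0"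
    by (subst Bochner_Integration.integral_sum[OF int_prod]) (auto simp: prod0)
  \<comment> \<open>By orthogonality the added linear term has expectation 0. Pointwise, the new
    integrand is the tangent of \<open>exp\<close> at \<open>c * S k t \<omega>\<close>, evaluated
    at \<open>c * S n t \<omega>\<close> and weighted by the indicator of \<open>A\<close>, so it
    lies below the target.\<close>
  have "expectation ?u = expectation (\<lambda>\<omega>. ?u \<omega> + c * (\<Sum>i\<in>{k<..n}. ?u \<omega> * g t (X i \<omega>)))"
    by (subst Bochner_Integration.integral_add)
      (auto simp: int_u sum0
        intro!: Bochner_Integration.integrable_sum integrable_mult_right int_prod)
  also have "\<dots> \<le> expectation (\<lambda>\<omega>. indicator A \<omega> * exp (c * S n t \<omega>))"
  proof (rule integral_mono)
    show "integrable M (\<lambda>\<omega>. ?u \<omega> + c * (\<Sum>i\<in>{k<..n}. ?u \<omega> * g t (X i \<omega>)))"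
      by (intro Bochner_Integration.integrable_add Bochner_Integration.integrable_sum
          integrable_mult_right int_prod int_u)
    show "integrable M (\<lambda>\<omega>. indicator A \<omega> * exp (c * S n t \<omega>))"
      by (rule integrable_const_bound[of _ "exp (\<bar>c\<bar> * real n)"])
        (auto simp: mult_S_bounded indicator_def)
    fix \<omega>
    have "(\<Sum>i\<in>{k<..n}. ?u \<omega> * g t (X i \<omega>)) = ?u \<omega> * (S n t \<omega> - S k t \<omega>)"
      by (simp add: S_split sum_distrib_left)
    then have "?u \<omega> + c * (\<Sum>i\<in>{k<..n}. ?u \<omega> * g t (X i \<omega>))
        = indicator A \<omega> * (exp (c * S k t \<omega>) * (1 + (c * S n t \<omega> - c * S k t \<omega>)))"
      by (simp only:) (simp add: algebra_simps)
    also have "\<dots> \<le> indicator A \<omega> * exp (c * S n t \<omega>)"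
      by (intro mult_left_mono exp_ge_tangent) auto
    finally show "?u \<omega> + c * (\<Sum>i\<in>{k<..n}. ?u \<omega> * g t (X i \<omega>))
      \<le> indicator A \<omega> * exp (c * S n t \<omega>)" .
  qed
  finally show ?thesis .
qed

text \<open>Doob's maximal inequality by decomposition at the first passage of level
  \<open>l\<close>. On \<open>A k\<close> the constant \<open>exp (c * l)\<close> is below the
  integral of \<open>Q k t\<close> over \<open>t\<close>; for each fixed \<open>t\<close> the
  submartingale property replaces \<open>k\<close> by \<open>n\<close>, and the disjoint pieces are
  then summed.\<close>

lemma absolute_moment_maximal_inequality:
  assumes "c > 0"
  shows "prob {\<omega> \<in> space M. \<exists>k\<in>{1..n}. l \<le> (\<integral>t. \<bar>S k t \<omega>\<bar> \<partial>\<nu>)}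
    \<le> 2 * exp (real n * c\<^sup>2 / 2 - c * l)"
proof -
  interpret P: pair_prob_space M \<nu> ..
  define N where "N k \<omega> = (\<integral>t. \<bar>S k t \<omega>\<bar> \<partial>\<nu>)" for k \<omega>
  \<comment> \<open>Dominates \<open>exp (c * \<bar>S k t \<omega>\<bar>)\<close>, while each
    summand is covered by the submartingale property, which holds for \<open>c\<close> of either
    sign.\<close>
  define Q where "Q k t \<omega> = exp (c * S k t \<omega>) + exp ((- c) * S k t \<omega>)" for k t \<omega>
  \<comment> \<open>The same norm as a function of sample values, so that first passage becomes a
    measurable predicate on vectors of length \<open>k\<close>, as the submartingale property
    demands.\<close>
  define N' where "N' j x = (\<integral>t. \<bar>\<Sum>i=1..j. g t (x i)\<bar> \<partial>\<nu>)" for j and x :: "nat \<Rightarrow> real"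
  define R where "R k x \<longleftrightarrow> l \<le> N' k x \<and> (\<forall>j\<in>{1..<k}. N' j x < l)" for k x
  \<comment> \<open>The event that the level \<open>l\<close> is first reached at time \<open>k\<close>, as an event in the first \<open>k\<close> samples.\<close>
  define A where "A k = {\<omega> \<in> space M. R k (\<lambda>i\<in>{1..k}. X i \<omega>)}" for k
  have N'_meas [measurable]: "N' j \<in> borel_measurable (Pi\<^sub>M {1..k} (\<lambda>_. borel))" if "j \<le> k" for j k
  proof -
    have [measurable]: "(\<lambda>(x, t). \<bar>\<Sum>i=1..j. g t (x i)\<bar>)
        \<in> borel_measurable (Pi\<^sub>M {1..k} (\<lambda>_. borel) \<Otimes>\<^sub>M \<nu>)"
      unfolding case_prod_beta
    proof (intro borel_measurable_abs borel_measurable_sum)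
      fix i assume "i \<in> {1..j}"
      then have [measurable]: "i \<in> {1..k}"
        using that by auto
      show "(\<lambda>p. g (snd p) (fst p i)) \<in> borel_measurable (Pi\<^sub>M {1..k} (\<lambda>_. borel) \<Otimes>\<^sub>M \<nu>)"
        by measurable
    qed
    show ?thesis
      unfolding N'_def by measurable
  qed
  have R_meas [measurable]: "Measurable.pred (Pi\<^sub>M {1..k} (\<lambda>_. borel)) (R k)" for k
    unfolding R_def by measurable
  have N'_eq: "N' j (\<lambda>i\<in>{1..k}. X i \<omega>) = N j \<omega>" if "j \<le> k" for j k \<omega>
    unfolding N_def N'_def S_def using that
    by (intro Bochner_Integration.integral_cong refl arg_cong[of _ _ abs] sum.cong) auto
  have A_eq: "A k = {\<omega> \<in> space M. l \<le> N k \<omega> \<and> (\<forall>j\<in>{1..<k}. N j \<omega> < l)}" for k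
  proof -
    have "R k (\<lambda>i\<in>{1..k}. X i \<omega>) \<longleftrightarrow> l \<le> N k \<omega> \<and> (\<forall>j\<in>{1..<k}. N j \<omega> < l)" for \<omega>
      unfolding R_def N'_eq[OF order_refl]
      by (intro conj_cong[OF refl] ball_cong[OF refl], subst N'_eq) simp_all
    then show ?thesis
      by (simp only: A_def)
  qed
  have A_sets [measurable]: "A k \<in> sets M" for k
    unfolding A_def by measurable
  have disj: "disjoint_family_on A {1..n}"
    unfolding disjoint_family_on_def
  proof (intro ballI impI)
    fix i j assume "i \<in> {1..n}" "j \<in> {1..n}" "i \<noteq> j"
    then show "A i \<inter> A j = {}"
      by (cases "i < j") (force simp: A_eq)+
  qed
  have cover: "{\<omega> \<in> space M. \<exists>k\<in>{1..n}. l \<le> N k \<omega>} \<subseteq> (\<Union>k\<in>{1..n}. A k)"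
  proof safe
    fix \<omega> k assume *: "\<omega> \<in> space M" "k \<in> {1..n}" "l \<le> N k \<omega>"
    define m where "m = (LEAST k. k \<in> {1..n} \<and> l \<le> N k \<omega>)"
    have "m \<in> {1..n} \<and> l \<le> N m \<omega>"
      unfolding m_def by (rule LeastI[of _ k]) (use * in auto)
    moreover have "N j \<omega> < l" if "j \<in> {1..<m}" for j
      using not_less_Least[of j "\<lambda>k. k \<in> {1..n} \<and> l \<le> N k \<omega>"] that calculation
      unfolding m_def[symmetric] by auto
    ultimately show "\<omega> \<in> (\<Union>k\<in>{1..n}. A k)"
      using * by (auto simp: A_eq)
  qed
  have Q_nonneg: "0 \<le> Q k t \<omega>" for k t \<omega>
    by (simp add: Q_def)
  have Q_bounded: "Q k t \<omega> \<le> 2 * exp (c * real k)" for k t \<omega>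
  proof -
    have "exp (c * S k t \<omega>) \<le> exp (c * real k)" "exp ((- c) * S k t \<omega>) \<le> exp (c * real k)"
      using mult_S_bounded[of c k t \<omega>] mult_S_bounded[of "- c" k t \<omega>] assms
      by (simp_all only: exp_le_cancel_iff abs_minus_cancel abs_of_pos)
    then show ?thesis
      unfolding Q_def by linarith
  qed
  have Q_pair [measurable]: "(\<lambda>(\<omega>, t). Q k t \<omega>) \<in> borel_measurable (M \<Otimes>\<^sub>M \<nu>)" for k
    unfolding Q_def by measurable
  have Q_meas [measurable]: "Q k t \<in> borel_measurable M" for k t
    unfolding Q_def[abs_def] by measurable
  have Q_param [measurable]: "(\<lambda>t. Q k t \<omega>) \<in> borel_measurable \<nu>" for k \<omega>
    unfolding Q_def[abs_def] by measurable
  have int_pair: "integrable (M \<Otimes>\<^sub>M \<nu>) (\<lambda>(\<omega>, t). indicator B \<omega> * Q k t \<omega>)"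
    if [measurable]: "B \<in> sets M" for B k
    by (rule P.P.integrable_const_bound[of _ "2 * exp (c * real k)"])
      (auto simp: Q_bounded Q_nonneg indicator_def)
  have int_Q: "integrable M (\<lambda>\<omega>. indicator B \<omega> * Q k t \<omega>)"
    if [measurable]: "B \<in> sets M" for B k t
    by (rule integrable_const_bound[of _ "2 * exp (c * real k)"])
      (auto simp: Q_bounded Q_nonneg indicator_def)
  have int_QE: "integrable \<nu> (\<lambda>t. expectation (\<lambda>\<omega>. indicator B \<omega> * Q k t \<omega>))"
    if "B \<in> sets M" for B k
    using P.integrable_snd[OF int_pair[OF that]] by simp
  \<comment> \<open>Jensen's inequality by hand: the tangent of \<open>exp\<close> at
    \<open>c * l\<close> is integrated over the probability measure \<nu>.\<close>
  have N_le: "exp (c * l) \<le> (\<integral>t. Q k t \<omega> \<partial>\<nu>)" if "l \<le> N k \<omega>" for k \<omega>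
  proof -
    have "exp (c * l) \<le> exp (c * l) * (1 + (c * N k \<omega> - c * l))"
      using that assms by (simp add: mult_left_mono)
    also have "\<dots> = (\<integral>t. exp (c * l) * (1 + (c * \<bar>S k t \<omega>\<bar> - c * l)) \<partial>\<nu>)"
      by (simp add: N_def integrable_abs_S \<nu>.prob_space)
    also have "\<dots> \<le> (\<integral>t. Q k t \<omega> \<partial>\<nu>)"
    proof (rule integral_mono)
      show "integrable \<nu> (\<lambda>t. exp (c * l) * (1 + (c * \<bar>S k t \<omega>\<bar> - c * l)))"
        by (simp add: integrable_abs_S)
      show "integrable \<nu> (\<lambda>t. Q k t \<omega>)"
        by (rule \<nu>.integrable_const_bound[of _ "2 * exp (c * real k)"])
          (auto simp: Q_bounded Q_nonneg)
      fix t
      have "exp (c * l) * (1 + (c * \<bar>S k t \<omega>\<bar> - c * l)) \<le> exp (c * \<bar>S k t \<omega>\<bar>)"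
        by (rule exp_ge_tangent)
      also have "\<dots> \<le> Q k t \<omega>"
        by (auto simp: Q_def abs_if)
      finally show "exp (c * l) * (1 + (c * \<bar>S k t \<omega>\<bar> - c * l)) \<le> Q k t \<omega>" .
    qed
    finally show ?thesis .
  qed
  \<comment> \<open>Fubini's theorem takes the integral over \<open>t\<close> outside, where time
    \<open>k\<close> can be replaced by \<open>n\<close> separately for each \<open>t\<close>. No
    supremum over \<open>t\<close> ever occurs.\<close>
  have A_prob: "exp (c * l) * prob (A k)
      \<le> (\<integral>t. expectation (\<lambda>\<omega>. indicator (A k) \<omega> * Q n t \<omega>) \<partial>\<nu>)" if "k \<in> {1..n}" for k
  proof -
    have "exp (c * l) * prob (A k) = expectation (\<lambda>\<omega>. exp (c * l) * indicator (A k) \<omega>)"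
      by simp
    also have "\<dots> \<le> expectation (\<lambda>\<omega>. \<integral>t. indicator (A k) \<omega> * Q k t \<omega> \<partial>\<nu>)"
    proof (rule integral_mono)
      show "integrable M (\<lambda>\<omega>. exp (c * l) * indicator (A k) \<omega>)"
        by (intro integrable_mult_right integrable_real_indicator A_sets) (simp add: less_top[symmetric])
      show "integrable M (\<lambda>\<omega>. \<integral>t. indicator (A k) \<omega> * Q k t \<omega> \<partial>\<nu>)"
        by (rule P.integrable_fst[OF int_pair]) simp
      show "exp (c * l) * indicator (A k) \<omega> \<le> (\<integral>t. indicator (A k) \<omega> * Q k t \<omega> \<partial>\<nu>)" for \<omega>
        using N_le[of k \<omega>] by (auto simp: A_eq indicator_def)
    qed
    also have "\<dots> = (\<integral>t. expectation (\<lambda>\<omega>. indicator (A k) \<omega> * Q k t \<omega>) \<partial>\<nu>)"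
      by (rule P.Fubini_integral[OF int_pair, symmetric]) simp
    also have "\<dots> \<le> (\<integral>t. expectation (\<lambda>\<omega>. indicator (A k) \<omega> * Q n t \<omega>) \<partial>\<nu>)"
    proof (rule integral_mono[OF int_QE int_QE])
      fix t
      have int: "integrable M (\<lambda>\<omega>. indicator (A k) \<omega> * exp (a * S j t \<omega>))" for a j
        by (rule integrable_const_bound[of _ "exp (\<bar>a\<bar> * real j)"])
          (auto simp: mult_S_bounded indicator_def)
      have "k \<le> n" using that by simp
      then show "expectation (\<lambda>\<omega>. indicator (A k) \<omega> * Q k t \<omega>)
        \<le> expectation (\<lambda>\<omega>. indicator (A k) \<omega> * Q n t \<omega>)"
        unfolding Q_def distrib_left
        by (subst (1 2) Bochner_Integration.integral_add[OF int int])
          (unfold A_def, intro add_mono expectation_indicator_exp_S_mono R_meas)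
    qed simp_all
    finally show ?thesis .
  qed
  have "exp (c * l) * prob {\<omega> \<in> space M. \<exists>k\<in>{1..n}. l \<le> N k \<omega>}
      \<le> exp (c * l) * prob (\<Union>k\<in>{1..n}. A k)"
    by (intro mult_left_mono finite_measure_mono cover) auto
  also have "\<dots> = (\<Sum>k=1..n. exp (c * l) * prob (A k))"
    by (subst finite_measure_finite_Union[OF _ _ disj]) (auto simp: sum_distrib_left)
  also have "\<dots> \<le> (\<Sum>k=1..n. \<integral>t. expectation (\<lambda>\<omega>. indicator (A k) \<omega> * Q n t \<omega>) \<partial>\<nu>)"
    by (intro sum_mono A_prob)
  also have "\<dots> = (\<integral>t. expectation (\<lambda>\<omega>. \<Sum>k=1..n. indicator (A k) \<omega> * Q n t \<omega>) \<partial>\<nu>)"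
    by (simp only: Bochner_Integration.integral_sum[OF int_Q[OF A_sets]]
        Bochner_Integration.integral_sum[OF int_QE[OF A_sets]])
  \<comment> \<open>The first-passage events are disjoint, so their indicators add up to one
    indicator; a factor \<open>n\<close> from a union bound is avoided.\<close>
  also have "\<dots> = (\<integral>t. expectation (\<lambda>\<omega>. indicator (\<Union>k\<in>{1..n}. A k) \<omega> * Q n t \<omega>) \<partial>\<nu>)"
    by (simp only: indicator_UN_disjoint[OF finite_atLeastAtMost disj] sum_distrib_right)
  also have "\<dots> \<le> (\<integral>t. 2 * exp (real n * c\<^sup>2 / 2) \<partial>\<nu>)"
  proof (rule integral_mono[OF int_QE])
    fix t
    have "expectation (\<lambda>\<omega>. indicator (\<Union>k\<in>{1..n}. A k) \<omega> * Q n t \<omega>)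
        \<le> expectation (\<lambda>\<omega>. indicator (space M) \<omega> * Q n t \<omega>)"
      by (rule integral_mono[OF int_Q int_Q]) (auto simp: indicator_def Q_nonneg)
    also have "\<dots> = expectation (Q n t)"
      by (rule Bochner_Integration.integral_cong) auto
    also have "\<dots> = expectation (\<lambda>\<omega>. exp (c * S n t \<omega>)) + expectation (\<lambda>\<omega>. exp ((- c) * S n t \<omega>))"
      unfolding Q_def by (intro Bochner_Integration.integral_add integrable_exp_S)
    also have "\<dots> \<le> 2 * exp (real n * c\<^sup>2 / 2)"
      using expectation_exp_S_le[of c n t] expectation_exp_S_le[of "- c" n t] by simp
    finally show "expectation (\<lambda>\<omega>. indicator (\<Union>k\<in>{1..n}. A k) \<omega> * Q n t \<omega>)
      \<le> 2 * exp (real n * c\<^sup>2 / 2)" .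
  qed auto
  also have "\<dots> = 2 * exp (real n * c\<^sup>2 / 2)"
    by (simp add: \<nu>.prob_space)
  finally show ?thesis
    unfolding N_def exp_diff by (simp add: pos_le_divide_eq mult.commute)
qed

text \<open>One maximal inequality per dyadic block, with levels making the probabilities of order
  1/k^2. Borel-Cantelli then leaves finitely many bad blocks, and within a block the level is
  comparable to sqrt(n log log n).\<close>

lemma bounded_LIL_absolute_moment:
  "AE \<omega> in M. \<forall>\<^sub>F n in sequentially.
     (\<integral>t. \<bar>S n t \<omega>\<bar> \<partial>\<nu>) \<le> 4 * sqrt (real n * ln (ln (real n)))"
proof -
  define N where "N n \<omega> = (\<integral>t. \<bar>S n t \<omega>\<bar> \<partial>\<nu>)" for n \<omega>
  \<comment> \<open>With m = 2^(k+1) and L = ln(k+1) this level satisfies l^2 / (2 m) = 2 L, which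
    turns the optimal exponential bound into a multiple of (k+1)^(-2).\<close>
  define l where "l k = 2 * sqrt (2 ^ Suc k * ln (real k + 1))" for k
  define E where "E k = {\<omega> \<in> space M. \<exists>n\<in>{1..2 ^ Suc k}. l k \<le> N n \<omega>}" for k :: nat
  have N_meas [measurable]: "N n \<in> borel_measurable M" for n
    unfolding N_def[abs_def] by measurable
  have E_sets: "E k \<in> sets M" for k
    unfolding E_def by measurable
  have E_prob: "prob (E k) \<le> 2 * (1 / (real k + 1)\<^sup>2)" if "k \<ge> 1" for k
  proof -
    define L where "L = ln (real k + 1)"
    define m :: real where "m = 2 ^ Suc k"
    \<comment> \<open>This is \<open>l k / m\<close>, the minimiser of the exponent m c^2 / 2 - c l.
      It is positive only for \<open>k \<ge> 1\<close>.\<close>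
    define c where "c = 2 * sqrt (L / m)"
    have L: "L > 0" and m: "m > 0"
      using that by (auto simp: L_def m_def)
    have "c > 0"
      using L m by (simp add: c_def)
    then have "prob (E k) \<le> 2 * exp (m * c\<^sup>2 / 2 - c * l k)"
      using absolute_moment_maximal_inequality[of c "2 ^ Suc k" "l k"]
      by (simp add: E_def N_def m_def)
    also have "m * c\<^sup>2 / 2 = 2 * L"
      using L m by (simp add: c_def power_mult_distrib)
    also have "c * l k = 4 * (sqrt (L / m) * sqrt (m * L))"
      by (simp add: c_def l_def L_def m_def)
    also have "sqrt (L / m) * sqrt (m * L) = L"
      using L m by (simp add: real_sqrt_mult[symmetric] power2_eq_square[symmetric])
    also have "exp (2 * L - 4 * L) = 1 / (real k + 1)\<^sup>2"
    proof -
      have "exp (2 * L) = (real k + 1)\<^sup>2"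
        by (simp add: L_def exp_double)
      then show ?thesis
        by (simp add: exp_minus inverse_eq_divide)
    qed
    finally show ?thesis .
  qed
  have "summable (\<lambda>k. 2 * (1 / (real (Suc k))\<^sup>2))"
    using inverse_power_summable[of 2, where ?'a = real]
    by (intro summable_mult) (subst summable_Suc_iff, simp add: inverse_eq_divide)
  then have "summable (\<lambda>k. prob (E k))"
    by (rule summable_comparison_test_ev[rotated])
      (use E_prob in \<open>auto intro!: eventually_sequentiallyI[of 1] simp: add.commute\<close>)
  then have "AE \<omega> in M. eventually (\<lambda>k. \<omega> \<in> space M - E k) sequentially"
    by (intro borel_cantelli_AE1 E_sets) (auto simp: less_top[symmetric])
  then show ?thesis
  proof (rule AE_mp, intro AE_I2 impI)
    fix \<omega> assume "eventually (\<lambda>k. \<omega> \<in> space M - E k) sequentially"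
    then obtain k0 where k0: "\<And>k. k \<ge> k0 \<Longrightarrow> \<omega> \<in> space M - E k"
      by (auto simp: eventually_sequentially)
    \<comment> \<open>The constant 4 makes 4 ln n at most (ln n)^2, which absorbs the bound k + 1
      \<le> 4 ln n below.\<close>
    have "\<forall>\<^sub>F n in sequentially. ln (real n) \<ge> 4"
      by real_asymp
    \<comment> \<open>Forces the dyadic block of \<open>n\<close> to have index greater than
      \<open>k0\<close>, hence to be a good one.\<close>
    moreover have "\<forall>\<^sub>F n in sequentially. n \<ge> 2 ^ Suc k0"
      by (rule eventually_ge_at_top)
    ultimately show "\<forall>\<^sub>F n in sequentially.
        (\<integral>t. \<bar>S n t \<omega>\<bar> \<partial>\<nu>) \<le> 4 * sqrt (real n * ln (ln (real n)))"
    proof eventually_elim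
      case (elim n)
      have "(1::nat) \<le> 2 ^ k0" by simp
      then have n: "n \<ge> 2"
        using elim unfolding power_Suc by linarith
      obtain k where k: "2 ^ k \<le> n" "n < 2 ^ Suc k"
        using ex_power_ivl1[of 2 n] n by auto
      have "(2::nat) ^ Suc k0 < 2 ^ Suc k"
        using elim k by linarith
      then have "k0 < k" by simp
      then have k1: "k \<ge> 1" by simp
      have "\<omega> \<in> space M - E k"
        using \<open>k0 < k\<close> by (intro k0 less_imp_le)
      then have "N n \<omega> < l k"
        using k n by (auto simp: E_def not_le)
      \<comment> \<open>Two factors 2 are lost under the root: 2^(k+1) \<le> 2 n, and ln(k+1) \<le>
        2 ln ln n because k is at most 2 ln n.\<close>
      also have "l k \<le> 2 * sqrt (4 * (real n * ln (ln (real n))))"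
      proof -
        have pow: "2 ^ k \<le> real n"
          using k(1) by (metis of_nat_le_iff of_nat_numeral of_nat_power)
        have "real k * (1 / 2) \<le> real k * ln 2"
          using ln2_ge_two_thirds by (intro mult_left_mono) auto
        also have "\<dots> = ln (2 ^ k)"
          by (simp add: ln_realpow)
        also have "\<dots> \<le> ln (real n)"
          using pow n by simp
        finally have "real k + 1 \<le> 4 * ln (real n)"
          using k1 by simp
        also have "\<dots> \<le> (ln (real n))\<^sup>2"
          using elim(1) by (simp add: power2_eq_square mult_right_mono)
        finally have "ln (real k + 1) \<le> ln ((ln (real n))\<^sup>2)"
          using elim(1) by (subst ln_le_cancel_iff) auto
        also have "\<dots> = 2 * ln (ln (real n))"
          using elim(1) by (simp add: ln_realpow)
        finally have "ln (real k + 1) \<le> 2 * ln (ln (real n))" .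
        then have "2 ^ Suc k * ln (real k + 1) \<le> (2 * real n) * (2 * ln (ln (real n)))"
          using pow by (intro mult_mono) auto
        then show ?thesis
          unfolding l_def by simp
      qed
      also have "\<dots> = 4 * sqrt (real n * ln (ln (real n)))"
        by (simp add: real_sqrt_mult)
      finally show ?case by (simp add: N_def)
    qed
  qed
qed

end

section \<open>Absence of ties and the closed form of the integrated empirical distribution
  function\<close>

text \<open>The joint law of two samples is a product measure by independence, and its factors have
  no atoms because \<open>F\<close> is continuous; so the diagonal is a null set. There are only
  countably many pairs.\<close>

lemma AE_inj_on_iid_continuous_df:
  assumes "prob_space M" "iid_with_df M X F" "continuous_on UNIV F"
  shows "AE \<omega> in M. inj_on (\<lambda>i. X i \<omega>) {1..}"
proof -
  interpret prob_space M by fact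
  have indep: "indep_vars (\<lambda>_. borel) X {1..}"
    and cdf: "\<And>i. i \<ge> 1 \<Longrightarrow> cdf (distr M borel (X i)) = F"
    using assms(2) by (auto simp: iid_with_df_def)
  have meas [measurable]: "X i \<in> borel_measurable M" if "i \<ge> 1" for i
    using indep that by (auto simp: indep_vars_def)
  have no_tie: "AE \<omega> in M. X i \<omega> \<noteq> X j \<omega>" if ij: "i \<ge> 1" "j \<ge> 1" "i \<noteq> j" for i j
  proof -
    note [measurable] = meas[OF ij(1)] meas[OF ij(2)]
    interpret Xi: real_distribution "distr M borel (X i)" by (rule real_distribution_distr) simp
    interpret Xj: real_distribution "distr M borel (X j)" by (rule real_distribution_distr) simp
    interpret P: pair_sigma_finite "distr M borel (X i)" "distr M borel (X j)" ..
    have null: "AE y in distr M borel (X j). x \<noteq> y" for x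
    proof -
      have "isCont (cdf (distr M borel (X j))) x"
        using assms(3) cdf[OF ij(2)] by (simp add: continuous_on_eq_continuous_at)
      then have "measure (distr M borel (X j)) {x} = 0"
        by (simp add: Xj.isCont_cdf)
      then have "{x} \<in> null_sets (distr M borel (X j))"
        by (simp add: null_sets_def Xj.emeasure_eq_measure)
      then show ?thesis
        by (rule AE_I'[of "{x}"]) auto
    qed
    have "indep_var borel ((\<lambda>x. x i) \<circ> (\<lambda>\<omega>. \<lambda>i\<in>{i}. X i \<omega>))
        borel ((\<lambda>x. x j) \<circ> (\<lambda>\<omega>. \<lambda>j\<in>{j}. X j \<omega>))"
      by (rule indep_var_compose[OF indep_var_restrict[OF indep]]) (use ij in auto)
    then have "indep_var borel (X i) borel (X j)"
      by (simp add: comp_def)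
    then have "distr M borel (X i) \<Otimes>\<^sub>M distr M borel (X j)
        = distr M (borel \<Otimes>\<^sub>M borel) (\<lambda>\<omega>. (X i \<omega>, X j \<omega>))"
      by (simp add: indep_var_distribution_eq)
    moreover have "AE p in distr M borel (X i) \<Otimes>\<^sub>M distr M borel (X j). fst p \<noteq> snd p"
    proof (rule P.AE_pair_measure)
      show "{p \<in> space (distr M borel (X i) \<Otimes>\<^sub>M distr M borel (X j)). fst p \<noteq> snd p}
          \<in> sets (distr M borel (X i) \<Otimes>\<^sub>M distr M borel (X j))"
        by measurable
    qed (simp add: null)
    ultimately have "AE p in distr M (borel \<Otimes>\<^sub>M borel) (\<lambda>\<omega>. (X i \<omega>, X j \<omega>)). fst p \<noteq> snd p"
      by (simp only:)
    then show ?thesis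
      by (subst (asm) AE_distr_iff) auto
  qed
  have "AE \<omega> in M. \<forall>i\<in>{1..}. \<forall>j\<in>{1..}. i \<noteq> j \<longrightarrow> X i \<omega> \<noteq> X j \<omega>"
    using no_tie by (auto simp: AE_ball_countable)
  then show ?thesis
    by eventually_elim (auto simp: inj_on_def)
qed

text \<open>Without ties, the samples up to \<open>t\<close> have ranks 1, ..., m, and a sample of
  rank r contributes r / n^2. The sum is m (m + 1) / (2 n^2).\<close>

lemma int_empirical_df_eq:
  assumes "inj_on (\<lambda>i. X i \<omega>) {1..n}"
  shows "int_empirical_df X n \<omega> t =
    ((empirical_df X n \<omega> t)\<^sup>2 + empirical_df X n \<omega> t / real n) / 2"
proof -
  define I :: "nat \<Rightarrow> real" where "I i = indicator {..t} (X i \<omega>)" for i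
  define m where "m = (\<Sum>i=1..n. I i)"
  define T where "T = (\<Sum>j=1..n. \<Sum>i=1..n. indicator {..X j \<omega>} (X i \<omega>) * I j)"
  \<comment> \<open>Symmetrise the double sum: each pair of distinct samples below \<open>t\<close> is ordered in exactly one way.\<close>
  have "2 * T = T + (\<Sum>j=1..n. \<Sum>i=1..n. indicator {..X i \<omega>} (X j \<omega>) * I i)"
  proof -
    have "T = (\<Sum>j=1..n. \<Sum>i=1..n. indicator {..X i \<omega>} (X j \<omega>) * I i)"
      unfolding T_def by (rule sum.swap)
    then show ?thesis by linarith
  qed
  \<comment> \<open>On the diagonal both orderings hold, so \<open>I j\<close> is counted twice
    there; this surplus produces the linear term.\<close>
  also have "\<dots> = (\<Sum>j=1..n. \<Sum>i=1..n. I j * I i + (if i = j then I j else 0))"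
    unfolding T_def sum.distrib[symmetric]
  proof (intro sum.cong refl)
    fix i j assume ij: "i \<in> {1..n}" "j \<in> {1..n}"
    show "indicator {..X j \<omega>} (X i \<omega>) * I j + indicator {..X i \<omega>} (X j \<omega>) * I i
        = I j * I i + (if i = j then I j else 0)"
    proof (cases "i = j")
      case False
      then have "X i \<omega> \<noteq> X j \<omega>"
        using inj_onD[OF assms] ij by blast
      with False show ?thesis
        by (auto simp: I_def indicator_def)
    qed (simp add: I_def indicator_def)
  qed
  also have "\<dots> = m\<^sup>2 + m"
    by (simp add: sum.distrib m_def power2_eq_square sum_product)
  finally have "T = (m\<^sup>2 + m) / 2" by simp
  moreover have "int_empirical_df X n \<omega> t = T / (real n)\<^sup>2"
    unfolding int_empirical_df_def empirical_df_def T_def I_def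
      sum_distrib_right[symmetric] mult.assoc sum_distrib_left[symmetric]
    by (simp add: power2_eq_square)
  moreover have "empirical_df X n \<omega> t = m / real n"
    by (simp add: empirical_df_def m_def I_def)
  ultimately show ?thesis
    by (simp add: power_divide add_divide_distrib power2_eq_square)
qed

section \<open>Suprema over the real line\<close>

text \<open>Reverse triangle inequality for the supremum norm. The bounds \<open>K\<close> and
  \<open>L\<close> ensure that the real suprema are genuine least upper bounds.\<close>

lemma abs_SUP_abs_diff_le:
  fixes u v :: "'b \<Rightarrow> real"
  assumes "\<And>t. \<bar>u t\<bar> \<le> K" "\<And>t. \<bar>v t\<bar> \<le> L"
  shows "\<bar>(SUP t. \<bar>u t\<bar>) - (SUP t. \<bar>v t\<bar>)\<bar> \<le> (SUP t. \<bar>u t - v t\<bar>)"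
proof -
  have bu: "bdd_above (range (\<lambda>t. \<bar>u t\<bar>))" and bv: "bdd_above (range (\<lambda>t. \<bar>v t\<bar>))"
    using assms by (auto intro!: bdd_aboveI2)
  have "\<bar>u t - v t\<bar> \<le> K + L" for t
    using assms[of t] by linarith
  then have bd: "bdd_above (range (\<lambda>t. \<bar>u t - v t\<bar>))"
    by (rule bdd_aboveI2)
  have "\<bar>u t\<bar> \<le> (SUP t. \<bar>v t\<bar>) + (SUP t. \<bar>u t - v t\<bar>)" for t
    using cSUP_upper[OF UNIV_I bv, of t] cSUP_upper[OF UNIV_I bd, of t] by linarith
  then have "(SUP t. \<bar>u t\<bar>) \<le> (SUP t. \<bar>v t\<bar>) + (SUP t. \<bar>u t - v t\<bar>)"
    by (intro cSUP_least) auto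
  moreover have "\<bar>v t\<bar> \<le> (SUP t. \<bar>u t\<bar>) + (SUP t. \<bar>u t - v t\<bar>)" for t
    using cSUP_upper[OF UNIV_I bu, of t] cSUP_upper[OF UNIV_I bd, of t] by linarith
  then have "(SUP t. \<bar>v t\<bar>) \<le> (SUP t. \<bar>u t\<bar>) + (SUP t. \<bar>u t - v t\<bar>)"
    by (intro cSUP_least) auto
  ultimately show ?thesis by linarith
qed

text \<open>Makes the supremum distance measurable by reducing it to countably many points. A strict
  inequality at \<open>t\<close> persists on an interval to the right of \<open>t\<close>, which
  contains a rational; this accommodates the jumps of the empirical process.\<close>

lemma SUP_right_continuous_eq_SUP_Rats:
  fixes h :: "real \<Rightarrow> real"
  assumes right_cont: "\<And>t. continuous (at_right t) h"
    and bdd: "bdd_above (range h)"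
  shows "(SUP t. h t) = (SUP q\<in>\<rat>. h q)"
proof (rule antisym)
  have bdd_Rats: "bdd_above (h ` \<rat>)"
    using bdd by (rule bdd_above_mono) auto
  show "(SUP t. h t) \<le> (SUP q\<in>\<rat>. h q)"
  proof (rule cSUP_least)
    fix t
    show "h t \<le> (SUP q\<in>\<rat>. h q)"
    proof (rule ccontr)
      assume "\<not> h t \<le> (SUP q\<in>\<rat>. h q)"
      then have "\<forall>\<^sub>F s in at_right t. (SUP q\<in>\<rat>. h q) < h s"
        using right_cont[of t] by (auto simp: continuous_within intro: order_tendstoD)
      then obtain b where b: "b > t" "\<And>s. t < s \<Longrightarrow> s < b \<Longrightarrow> (SUP q\<in>\<rat>. h q) < h s"
        by (auto simp: eventually_at_right_field)
      obtain q where "q \<in> \<rat>" "t < q" "q < b"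
        using Rats_dense_in_real[OF b(1)] by auto
      then show False
        using b(2)[of q] cSUP_upper[OF _ bdd_Rats, of q] by simp
    qed
  qed simp
  show "(SUP q\<in>\<rat>. h q) \<le> (SUP t. h t)"
    by (rule cSUP_subset_mono[OF _ bdd]) (use Rats_0 in auto)
qed

lemma continuous_at_right_indicator_atMost:
  "continuous (at_right t) (\<lambda>s. indicator {..s} x :: real)" for t x :: real
proof -
  have "\<forall>\<^sub>F s in at_right t. indicator {..s} x = (indicator {..t} x :: real)"
  proof (cases "x \<le> t")
    case True
    show ?thesis
      using eventually_at_right_less[of t] by eventually_elim (use True in auto)
  next
    case False
    then have "\<forall>\<^sub>F s in at_right t. s < x"
      by (intro eventually_at_right_real[THEN eventually_mono]) auto
    then show ?thesis
      by eventually_elim (use False in auto)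
  qed
  then show ?thesis
    unfolding continuous_within by (rule tendsto_eventually)
qed

lemma continuous_at_right_int_empirical_process:
  assumes "continuous_on UNIV F"
  shows "continuous (at_right t) (int_empirical_process X F n \<omega>)"
proof -
  have "continuous (at_right t) F"
    using assms by (simp add: continuous_on_eq_continuous_at continuous_at_imp_continuous_at_within)
  then show ?thesis
    unfolding int_empirical_process_def[abs_def] int_empirical_df_def int_df_def
    by (intro continuous_intros continuous_at_right_indicator_atMost)
qed

section \<open>Estimates for the integrated empirical process\<close>

lemma empirical_df_bounds:
  shows empirical_df_nonneg: "0 \<le> empirical_df X n \<omega> t"
    and empirical_df_le_1: "empirical_df X n \<omega> t \<le> 1"
proof -
  show "0 \<le> empirical_df X n \<omega> t"
    by (simp add: empirical_df_def sum_nonneg)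
  have "(\<Sum>i=1..n. indicator {..t} (X i \<omega>) :: real) \<le> (\<Sum>i=1..n. 1)"
    by (intro sum_mono) (auto simp: indicator_def)
  \<comment> \<open>For \<open>n = 0\<close> the sum is empty and the value is 0.\<close>
  then show "empirical_df X n \<omega> t \<le> 1"
    by (cases "n = 0") (simp_all add: empirical_df_def)
qed

lemma int_empirical_df_bounds:
  shows int_empirical_df_nonneg: "0 \<le> int_empirical_df X n \<omega> t"
    and int_empirical_df_le_1: "int_empirical_df X n \<omega> t \<le> 1"
proof -
  show "0 \<le> int_empirical_df X n \<omega> t"
    by (simp add: int_empirical_df_def empirical_df_nonneg sum_nonneg)
  have "(\<Sum>j=1..n. empirical_df X n \<omega> (X j \<omega>) * indicator {..t} (X j \<omega>)) \<le> (\<Sum>j=1..n. 1)"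
    by (intro sum_mono) (auto simp: indicator_def empirical_df_le_1)
  then show "int_empirical_df X n \<omega> t \<le> 1"
    by (cases "n = 0") (simp_all add: int_empirical_df_def)
qed

text \<open>A crude bound that serves boundedness of suprema and integrability; it gives no
  rate.\<close>

lemma abs_int_empirical_process_le:
  assumes "0 \<le> F t" "F t \<le> 1"
  shows "\<bar>int_empirical_process X F n \<omega> t\<bar> \<le> sqrt (real n)"
proof -
  have "0 \<le> int_df F t" "int_df F t \<le> 1"
    using assms power_le_one[of "F t" 2] by (auto simp: int_df_def)
  then have "\<bar>int_empirical_df X n \<omega> t - int_df F t\<bar> \<le> 1"
    using int_empirical_df_nonneg[of X n \<omega> t] int_empirical_df_le_1[of X n \<omega> t] by linarith
  then show ?thesis
    by (simp add: int_empirical_process_def abs_mult mult_left_le)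
qed

text \<open>Factor the difference of squares and use |u + v| \<le> 2 |u| + d. Thus only the L1-norm
  of \<open>u\<close> enters the estimate, while \<open>K\<close> and \<open>L\<close> provide
  integrability.\<close>

lemma (in prob_space) abs_integral_power2_diff_le:
  fixes u v :: "'a \<Rightarrow> real"
  assumes [measurable]: "u \<in> borel_measurable M" "v \<in> borel_measurable M"
    and u: "\<And>x. \<bar>u x\<bar> \<le> K" and v: "\<And>x. \<bar>v x\<bar> \<le> L" and d: "\<And>x. \<bar>u x - v x\<bar> \<le> d"
  shows "\<bar>(LINT x|M. (u x)\<^sup>2) - (LINT x|M. (v x)\<^sup>2)\<bar> \<le> d * (2 * (LINT x|M. \<bar>u x\<bar>) + d)"
proof -
  have int_u2: "integrable M (\<lambda>x. (u x)\<^sup>2)"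
    by (rule integrable_const_bound[of _ "K\<^sup>2"]) (auto intro!: power2_le_iff_abs_le[THEN iffD2] u
        intro: order_trans[OF abs_ge_zero u])
  have int_v2: "integrable M (\<lambda>x. (v x)\<^sup>2)"
    by (rule integrable_const_bound[of _ "L\<^sup>2"]) (auto intro!: power2_le_iff_abs_le[THEN iffD2] v
        intro: order_trans[OF abs_ge_zero v])
  have int_u: "integrable M (\<lambda>x. \<bar>u x\<bar>)"
    by (rule integrable_const_bound[of _ K]) (auto simp: u)
  have "\<bar>(LINT x|M. (u x)\<^sup>2) - (LINT x|M. (v x)\<^sup>2)\<bar> = \<bar>LINT x|M. (u x)\<^sup>2 - (v x)\<^sup>2\<bar>"
    by (simp add: int_u2 int_v2)
  also have "\<dots> \<le> (LINT x|M. \<bar>(u x)\<^sup>2 - (v x)\<^sup>2\<bar>)"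
    by (rule integral_abs_bound)
  also have "\<dots> \<le> (LINT x|M. d * (2 * \<bar>u x\<bar> + d))"
  proof (rule integral_mono)
    show "integrable M (\<lambda>x. \<bar>(u x)\<^sup>2 - (v x)\<^sup>2\<bar>)"
      by (intro integrable_abs Bochner_Integration.integrable_diff int_u2 int_v2)
    show "integrable M (\<lambda>x. d * (2 * \<bar>u x\<bar> + d))"
      by (simp add: int_u)
    fix x
    have "\<bar>(u x)\<^sup>2 - (v x)\<^sup>2\<bar> = \<bar>u x - v x\<bar> * \<bar>u x + v x\<bar>"
      by (simp add: power2_eq_square square_diff_square_factored abs_mult mult.commute)
    also have "\<dots> \<le> d * (2 * \<bar>u x\<bar> + d)"
      using d[of x] by (intro mult_mono) linarith+
    finally show "\<bar>(u x)\<^sup>2 - (v x)\<^sup>2\<bar> \<le> d * (2 * \<bar>u x\<bar> + d)" .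
  qed
  also have "\<dots> = d * (2 * (LINT x|M. \<bar>u x\<bar>) + d)"
    by (simp add: int_u prob_space)
  finally show ?thesis .
qed

text \<open>Borel-Cantelli with a deviation \<open>x\<close> growing like log n: the term A log n in
  the threshold is already of that order, so the rate is unaffected.\<close>

lemma (in prob_space) AE_eventually_le_ln_over_sqrt:
  fixes D :: "nat \<Rightarrow> 'a \<Rightarrow> real"
  assumes D [measurable]: "\<And>n. n \<ge> 1 \<Longrightarrow> D n \<in> borel_measurable M"
    and tail: "\<forall>\<^sub>F x in at_top. \<forall>n\<ge>1.
      \<P>(\<omega> in M. D n \<omega> \<ge> (1 / sqrt (real n)) * (A * ln (real n) + x)) \<le> B * exp (- C * x)"
    and "C > 0"
  shows "AE \<omega> in M. \<forall>\<^sub>F n in sequentially.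
    D n \<omega> \<le> (A + 2 / C) * (ln (real n) / sqrt (real n))"
proof -
  \<comment> \<open>Chosen so that \<open>exp (- C * x n)\<close> equals 1 / n^2, which is
    summable.\<close>
  define x where "x n = 2 / C * ln (real n)" for n :: nat
  define E where "E n = (if n = 0 then {}
    else {\<omega> \<in> space M. D n \<omega> \<ge> (1 / sqrt (real n)) * (A * ln (real n) + x n)})" for n
  have E_sets: "E n \<in> sets M" for n
  proof (cases "n = 0")
    case False
    then have [measurable]: "D n \<in> borel_measurable M"
      using D by simp
    from False show ?thesis
      by (simp add: E_def)
  qed (simp add: E_def)
  have "filterlim (\<lambda>n. ln (real n)) at_top sequentially"
    by (rule filterlim_compose[OF ln_at_top filterlim_real_sequentially])
  then have "filterlim x at_top sequentially"
    unfolding x_def[abs_def] using \<open>C > 0\<close>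
    by (intro filterlim_tendsto_pos_mult_at_top[OF tendsto_const]) auto
  \<comment> \<open>Uniformity of the threshold for \<open>x\<close> matters here: once
    \<open>x n\<close> has passed it, the tail bound holds for every \<open>m\<close>, in particular
    for \<open>m = n\<close>.\<close>
  then have "\<forall>\<^sub>F n in sequentially. \<forall>m\<ge>1.
      \<P>(\<omega> in M. D m \<omega> \<ge> (1 / sqrt (real m)) * (A * ln (real m) + x n)) \<le> B * exp (- C * x n)"
    by (rule eventually_compose_filterlim[OF tail])
  then have "\<forall>\<^sub>F n in sequentially. norm (prob (E n)) \<le> B * (1 / (real n)\<^sup>2)"
    using eventually_ge_at_top[of 1]
  proof eventually_elim
    case (elim n)
    have "exp (- C * x n) = inverse (exp (2 * ln (real n)))"
      using \<open>C > 0\<close> by (simp add: x_def exp_minus)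
    also have "\<dots> = 1 / (real n)\<^sup>2"
      using elim(2) by (simp add: exp_double inverse_eq_divide)
    finally show ?case
      using elim by (simp add: E_def)
  qed
  moreover have "summable (\<lambda>n. B * (1 / (real n)\<^sup>2))"
    using inverse_power_summable[of 2, where ?'a = real]
    by (intro summable_mult) (simp add: inverse_eq_divide)
  ultimately have "summable (\<lambda>n. prob (E n))"
    by (rule summable_comparison_test_ev)
  then have "AE \<omega> in M. \<forall>\<^sub>F n in sequentially. \<omega> \<in> space M - E n"
    by (intro borel_cantelli_AE1 E_sets) (auto simp: less_top[symmetric])
  then show ?thesis
  proof (rule AE_mp, intro AE_I2 impI)
    fix \<omega> assume "\<omega> \<in> space M" "\<forall>\<^sub>F n in sequentially. \<omega> \<in> space M - E n"
    from this(2) show "\<forall>\<^sub>F n in sequentially. D n \<omega> \<le> (A + 2 / C) * (ln (real n) / sqrt (real n))"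
      using eventually_ge_at_top[of 1]
    proof eventually_elim
      case (elim n)
      then have "D n \<omega> < (1 / sqrt (real n)) * (A * ln (real n) + x n)"
        by (auto simp: E_def not_le)
      then show ?case
        by (simp add: x_def algebra_simps add_divide_distrib)
    qed
  qed
qed

text \<open>In E^2 - F^2 = (E - F) (E + F) the second factor is at most 2 and cancels the 1/2. The
  summand 1 accounts for the correction E / n in the closed form.\<close>

lemma abs_int_empirical_process_le_empirical_sum:
  assumes "inj_on (\<lambda>i. X i \<omega>) {1..n}" "n \<ge> 1" "0 \<le> F t" "F t \<le> 1"
  shows "\<bar>int_empirical_process X F n \<omega> t\<bar>
    \<le> (\<bar>\<Sum>i=1..n. indicator {..t} (X i \<omega>) - F t\<bar> + 1) / sqrt (real n)"
proof -
  define E where "E = empirical_df X n \<omega> t"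
  have E: "0 \<le> E" "E \<le> 1"
    by (simp_all add: E_def empirical_df_nonneg empirical_df_le_1)
  have "\<bar>E - F t\<bar> * \<bar>E + F t\<bar> \<le> \<bar>E - F t\<bar> * 2"
    using E assms by (intro mult_left_mono) auto
  then have "\<bar>E\<^sup>2 - (F t)\<^sup>2\<bar> \<le> 2 * \<bar>E - F t\<bar>"
    by (simp add: power2_eq_square square_diff_square_factored abs_mult mult.commute)
  moreover have "0 \<le> E / real n" "E / real n \<le> 1 / real n"
    using E by (auto simp: divide_right_mono)
  moreover have "int_empirical_df X n \<omega> t - int_df F t = (E\<^sup>2 - (F t)\<^sup>2 + E / real n) / 2"
    by (simp add: int_empirical_df_eq[of X \<omega> n, OF assms(1)] int_df_def E_def field_simps)
  moreover have "\<bar>y\<bar> \<le> d + r"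
    if "\<bar>q\<bar> \<le> 2 * d" "0 \<le> e" "e \<le> r" "y = (q + e) / 2" for y q d e r :: real
    using that by (auto simp: abs_le_iff)
  ultimately have "\<bar>int_empirical_df X n \<omega> t - int_df F t\<bar> \<le> \<bar>E - F t\<bar> + 1 / real n"
    by blast
  then have "\<bar>int_empirical_process X F n \<omega> t\<bar> \<le> sqrt (real n) * (\<bar>E - F t\<bar> + 1 / real n)"
    by (simp add: int_empirical_process_def abs_mult mult_left_mono)
  also have "E - F t = (\<Sum>i=1..n. indicator {..t} (X i \<omega>) - F t) / real n"
    using assms(2) by (simp add: E_def empirical_df_def sum_subtractf diff_divide_distrib)
  also have "sqrt (real n) * (\<bar>\<dots>\<bar> + 1 / real n)
      = (\<bar>\<Sum>i=1..n. indicator {..t} (X i \<omega>) - F t\<bar> + 1) * (sqrt (real n) / real n)"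
    by (simp add: abs_divide field_simps add_divide_distrib)
  also have "sqrt (real n) / real n = 1 / sqrt (real n)"
    by (simp add: sqrt_divide_self_eq inverse_eq_divide)
  finally show ?thesis by simp
qed

section \<open>Almost sure rates for the two statistics\<close>

theorem corollary2p7:
  fixes M :: "'a measure"
    and X :: "nat \<Rightarrow> 'a \<Rightarrow> real"
    and F F0 :: "real \<Rightarrow> real"
    and BB :: "nat \<Rightarrow> real \<Rightarrow> 'a \<Rightarrow> real"
  assumes "prob_space M"
    and "iid_with_df M X F"
    and "continuous_on UNIV F"
    and "continuous_df F0"
    and null_hypothesis: "F = F0"
    and "suitable_space M X"
    and "\<And>n. n \<ge> 1 \<Longrightarrow> brownian_bridge M (BB n)"
    and "\<exists>A>0. \<exists>B>0. \<exists>C>0. bridge_approximation M X F BB A B C"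
  shows "AE \<omega> in M.
     (\<lambda>n. \<bar>int_KS_stat X F0 n \<omega> - (SUP t. \<bar>F t * BB n (F t) \<omega>\<bar>)\<bar>)
       \<in> O(\<lambda>n. ln (real n) / sqrt (real n)) \<and>
     (\<lambda>n. \<bar>int_CvM_stat X F0 n \<omega>
            - (LINT t|interval_measure F0. (F t * BB n (F t) \<omega>)\<^sup>2)\<bar>)
       \<in> O(\<lambda>n. sqrt (ln (ln (real n)) / real n) * ln (real n))"
proof -
  interpret prob_space M by fact
  have indep: "indep_vars (\<lambda>_. borel) X {1..}"
    and cdf_X: "\<And>i. i \<ge> 1 \<Longrightarrow> cdf (distr M borel (X i)) = F"
    using assms(2) by (auto simp: iid_with_df_def)
  have X_meas: "X i \<in> borel_measurable M" if "i \<ge> 1" for i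
    using indep that by (auto simp: indep_vars_def)
  have F_cont: "continuous_on UNIV F" by fact
  have F_mono: "mono F" and F_lims: "(F \<longlongrightarrow> 0) at_bot" "(F \<longlongrightarrow> 1) at_top"
    using assms(4) null_hypothesis by (auto simp: continuous_df_def)
  have F_meas [measurable]: "F \<in> borel_measurable borel"
    using F_cont by (rule borel_measurable_continuous_onI)
  have F_bounds: "0 \<le> F t" "F t \<le> 1" for t
  proof -
    interpret X1: real_distribution "distr M borel (X 1)"
      using X_meas[of 1] by (intro real_distribution_distr) simp
    show "0 \<le> F t" "F t \<le> 1"
      using X1.cdf_nonneg[of t] X1.cdf_bounded_prob[of t] cdf_X[of 1] by auto
  qed
  define \<nu> where "\<nu> = interval_measure F0"
  interpret \<nu>: real_distribution \<nu>
    unfolding \<nu>_def null_hypothesis[symmetric]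
    by (rule real_distribution_interval_measure)
      (use F_lims F_cont monoD[OF F_mono] in
        \<open>auto simp: continuous_on_eq_continuous_at continuous_at_imp_continuous_at_within\<close>)
  \<comment> \<open>With this kernel \<open>K.S n t\<close> is \<open>real n\<close> times the
    difference between the empirical distribution function and \<open>F\<close>.\<close>
  interpret K: mean_zero_kernel M \<nu> X "\<lambda>t x. indicator {..t} x - F t"
  proof unfold_locales
    show "(\<lambda>(t, x). indicator {..t} x - F t) \<in> borel_measurable (borel \<Otimes>\<^sub>M borel)"
    proof -
      have "(\<lambda>p :: real \<times> real. if snd p \<le> fst p then 1 - F (fst p) else - F (fst p))
          \<in> borel_measurable (borel \<Otimes>\<^sub>M borel)"
        by measurable
      then show ?thesis
        by (rule measurable_cong[THEN iffD1, rotated]) (auto simp: indicator_def)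
    qed
    show "\<bar>indicator {..t} x - F t\<bar> \<le> 1" for t x
      using F_bounds[of t] by (auto simp: indicator_def)
    show "expectation (\<lambda>\<omega>. indicator {..t} (X i \<omega>) - F t) = 0" if "i \<ge> 1" for i t
    proof -
      have [measurable]: "X i \<in> borel_measurable M"
        using X_meas that by simp
      have "F t = prob (X i -` {..t} \<inter> space M)"
        using cdf_X[OF that] by (auto simp: cdf_def measure_distr)
      also have "\<dots> = expectation (indicator (X i -` {..t} \<inter> space M))"
        by simp
      also have "\<dots> = expectation (\<lambda>\<omega>. indicator {..t} (X i \<omega>))"
        by (rule Bochner_Integration.integral_cong) (auto simp: indicator_def)
      finally have "expectation (\<lambda>\<omega>. indicator {..t} (X i \<omega>)) = F t"
        by simp
      moreover have "integrable M (\<lambda>\<omega>. indicator {..t} (X i \<omega>) :: real)"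
        by (rule integrable_const_bound[of _ 1]) auto
      ultimately show ?thesis
        by (simp add: prob_space)
    qed
  qed (use indep in simp_all)

  \<comment> \<open>Finiteness and measurability of the supremum distance \<open>D n\<close>\<close>
  define a where "a n \<omega> t = int_empirical_process X F n \<omega> t" for n \<omega> t
  define b where "b n \<omega> t = F t * BB n (F t) \<omega>" for n \<omega> t
  define D where "D n \<omega> = (SUP t. \<bar>a n \<omega> t - b n \<omega> t\<bar>)" for n \<omega>
  have a_le: "\<bar>a n \<omega> t\<bar> \<le> sqrt (real n)" for n \<omega> t
    unfolding a_def by (intro abs_int_empirical_process_le F_bounds)
  have BB_cont: "continuous_on {0..1} (\<lambda>u. BB n u \<omega>)" if "n \<ge> 1" "\<omega> \<in> space M" for n \<omega>
    using assms(7)[OF that(1)] that(2) by (auto simp: brownian_bridge_def)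
  have BB_meas: "BB n u \<in> borel_measurable M" if "n \<ge> 1" "u \<in> {0..1}" for n u
  proof -
    have *: "gaussian_rv M (\<lambda>\<omega>. \<Sum>u\<in>S. c u * BB n u \<omega>)" if "finite S" "S \<subseteq> {0..1}" for S c
      using assms(7)[OF \<open>n \<ge> 1\<close>] that
      by (auto simp: brownian_bridge_def centered_gaussian_process_def)
    show ?thesis
      \<comment> \<open>Measurability is part of \<open>gaussian_rv\<close>; the linear combination
        with the single coefficient 1 yields it for \<open>BB n u\<close>.\<close>
      using *[of "{u}" "\<lambda>_. 1"] that(2) by (simp add: gaussian_rv_def)
  qed
  have b_cont: "continuous_on UNIV (b n \<omega>)" if "n \<ge> 1" "\<omega> \<in> space M" for n \<omega>
    unfolding b_def[abs_def]
    by (intro continuous_on_mult F_cont continuous_on_compose2[OF BB_cont[OF that] F_cont])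
      (auto simp: F_bounds)
  have b_bounded: "\<exists>L. \<forall>t. \<bar>b n \<omega> t\<bar> \<le> L" if "n \<ge> 1" "\<omega> \<in> space M" for n \<omega>
  proof -
    \<comment> \<open>The path \<open>b n \<omega>\<close> factors through [0, 1], where u B_n(u) is
      continuous and hence bounded.\<close>
    have "compact ((\<lambda>u. u * BB n u \<omega>) ` {0..1})"
      by (intro compact_continuous_image continuous_intros BB_cont that compact_Icc)
    then obtain L where "\<And>y. y \<in> (\<lambda>u. u * BB n u \<omega>) ` {0..1} \<Longrightarrow> \<bar>y\<bar> \<le> L"
      using compact_imp_bounded bounded_real by metis
    then show ?thesis
      by (intro exI[of _ L]) (auto simp: b_def F_bounds)
  qed
  have D_bdd: "bdd_above (range (\<lambda>t. \<bar>a n \<omega> t - b n \<omega> t\<bar>))" if n\<omega>: "n \<ge> 1" "\<omega> \<in> space M" for n \<omega>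
  proof -
    obtain L where L: "\<And>t. \<bar>b n \<omega> t\<bar> \<le> L"
      using b_bounded[OF n\<omega>] by blast
    have "\<bar>a n \<omega> t - b n \<omega> t\<bar> \<le> sqrt (real n) + L" for t
      using a_le[of n \<omega> t] L[of t] by linarith
    then show ?thesis
      by (rule bdd_aboveI2)
  qed
  \<comment> \<open>Non-measurable sets have measure 0 by default, so the exponential inequality
    carries information only once \<open>D n\<close> is known to be measurable.\<close>
  have D_meas: "D n \<in> borel_measurable M" if n: "n \<ge> 1" for n
  proof -
    have eq: "D n \<omega> = (SUP t\<in>\<rat>. \<bar>a n \<omega> t - b n \<omega> t\<bar>)" if \<omega>: "\<omega> \<in> space M" for \<omega>
      unfolding D_def
    proof (rule SUP_right_continuous_eq_SUP_Rats[OF _ D_bdd[OF n \<omega>]])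
      fix t
      have "continuous (at_right t) (b n \<omega>)"
        using b_cont[OF n \<omega>]
        by (simp add: continuous_on_eq_continuous_at continuous_at_imp_continuous_at_within)
      moreover have "continuous (at_right t) (a n \<omega>)"
        unfolding a_def[abs_def] using F_cont by (rule continuous_at_right_int_empirical_process)
      ultimately show "continuous (at_right t) (\<lambda>t. \<bar>a n \<omega> t - b n \<omega> t\<bar>)"
        by (intro continuous_intros)
    qed
    have "(\<lambda>\<omega>. SUP t\<in>\<rat>. \<bar>a n \<omega> t - b n \<omega> t\<bar>) \<in> borel_measurable M"
    proof (rule borel_measurable_cSUP)
      fix t :: real
      have [measurable]: "BB n (F t) \<in> borel_measurable M"
        by (rule BB_meas[OF n]) (simp add: F_bounds)
      have ind: "(\<lambda>\<omega>. indicator {..X j \<omega>} (X i \<omega>) :: real) \<in> borel_measurable M"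
        if "i \<in> {1..n}" "j \<in> {1..n}" for i j
      proof -
        note [measurable] = X_meas
        have [measurable]: "i \<ge> 1" "j \<ge> 1"
          using that by auto
        have "(\<lambda>\<omega>. if X i \<omega> \<le> X j \<omega> then 1 else 0 :: real) \<in> borel_measurable M"
          by measurable
        then show ?thesis
          by (simp add: indicator_def)
      qed
      show "(\<lambda>\<omega>. \<bar>a n \<omega> t - b n \<omega> t\<bar>) \<in> borel_measurable M"
        unfolding a_def b_def int_empirical_process_def int_empirical_df_def empirical_df_def
        by (intro borel_measurable_abs borel_measurable_diff borel_measurable_times
            borel_measurable_sum borel_measurable_const ind) measurable
    next
      fix \<omega> assume "\<omega> \<in> space M"
      then show "bdd_above ((\<lambda>t. \<bar>a n \<omega> t - b n \<omega> t\<bar>) ` \<rat>)"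
        by (rule bdd_above_mono[OF D_bdd[OF n]]) auto
    qed (rule countable_rat)
    then show ?thesis
      by (rule measurable_cong[THEN iffD2, rotated]) (rule eq)
  qed

  \<comment> \<open>Almost sure rate of \<open>D n\<close>\<close>
  obtain A B C where ABC: "A > 0" "B > 0" "C > 0" and approx: "bridge_approximation M X F BB A B C"
    using assms(8) by blast
  define c where "c = A + 2 / C"
  have "c > 0"
    using ABC by (simp add: c_def add_pos_pos)
  have AE_D: "AE \<omega> in M. \<forall>\<^sub>F n in sequentially. D n \<omega> \<le> c * (ln (real n) / sqrt (real n))"
  proof -
    have "\<forall>\<^sub>F x in at_top. \<forall>n\<ge>1.
        \<P>(\<omega> in M. D n \<omega> \<ge> (1 / sqrt (real n)) * (A * ln (real n) + x)) \<le> B * exp (- C * x)"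
      using approx by (simp only: bridge_approximation_def D_def a_def b_def)
    then show ?thesis
      unfolding c_def by (intro AE_eventually_le_ln_over_sqrt D_meas ABC)
  qed
  have AE_inj: "AE \<omega> in M. inj_on (\<lambda>i. X i \<omega>) {1..}"
    using AE_inj_on_iid_continuous_df assms(1-3) .

  \<comment> \<open>Pathwise comparison outside a null set\<close>
  show ?thesis
    using AE_D AE_inj K.bounded_LIL_absolute_moment AE_space
  proof eventually_elim
    case (elim \<omega>)
    note \<omega> = elim(4)
    have D_upper: "\<bar>a n \<omega> t - b n \<omega> t\<bar> \<le> D n \<omega>" if "n \<ge> 1" for n t
      unfolding D_def by (rule cSUP_upper[OF UNIV_I D_bdd[OF that \<omega>]])
    have KS: "\<bar>int_KS_stat X F0 n \<omega> - (SUP t. \<bar>F t * BB n (F t) \<omega>\<bar>)\<bar> \<le> D n \<omega>" if n: "n \<ge> 1" for n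
    proof -
      obtain L where L: "\<And>t. \<bar>b n \<omega> t\<bar> \<le> L"
        using b_bounded[OF n \<omega>] by blast
      have "int_KS_stat X F0 n \<omega> = (SUP t. \<bar>a n \<omega> t\<bar>)"
        by (simp add: int_KS_stat_def a_def int_empirical_process_def null_hypothesis)
      then show ?thesis
        using abs_SUP_abs_diff_le[of "a n \<omega>" "sqrt (real n)" "b n \<omega>" L] a_le L
        by (simp add: D_def b_def)
    qed
    have a_integral: "(LINT t|\<nu>. \<bar>a n \<omega> t\<bar>) \<le> ((LINT t|\<nu>. \<bar>K.S n t \<omega>\<bar>) + 1) / sqrt (real n)"
      and CvM: "\<bar>int_CvM_stat X F0 n \<omega> - (LINT t|interval_measure F0. (F t * BB n (F t) \<omega>)\<^sup>2)\<bar>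
        \<le> D n \<omega> * (2 * (LINT t|\<nu>. \<bar>a n \<omega> t\<bar>) + D n \<omega>)" if n: "n \<ge> 1" for n
    proof -
      obtain L where L: "\<And>t. \<bar>b n \<omega> t\<bar> \<le> L"
        using b_bounded[OF n \<omega>] by blast
      have a_meas: "a n \<omega> \<in> borel_measurable borel"
      proof -
        have [measurable]: "(\<lambda>t. indicator {..t} x :: real) \<in> borel_measurable borel" for x :: real
          by (simp add: indicator_def)
        show ?thesis
          unfolding a_def[abs_def] int_empirical_process_def int_empirical_df_def int_df_def
          by measurable
      qed
      note [measurable] = \<nu>.measurable_finite_borel[OF a_meas]
        \<nu>.measurable_finite_borel[OF borel_measurable_continuous_onI[OF b_cont[OF n \<omega>]]]
      have "int_CvM_stat X F0 n \<omega> = (LINT t|\<nu>. (a n \<omega> t)\<^sup>2)"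
        by (simp add: int_CvM_stat_def a_def int_empirical_process_def null_hypothesis \<nu>_def
            power_mult_distrib)
      then show "\<bar>int_CvM_stat X F0 n \<omega> - (LINT t|interval_measure F0. (F t * BB n (F t) \<omega>)\<^sup>2)\<bar>
        \<le> D n \<omega> * (2 * (LINT t|\<nu>. \<bar>a n \<omega> t\<bar>) + D n \<omega>)"
        using \<nu>.abs_integral_power2_diff_le[of "a n \<omega>" "b n \<omega>", OF _ _ a_le L D_upper[OF n]]
        by (simp add: b_def \<nu>_def)
      have "(LINT t|\<nu>. \<bar>a n \<omega> t\<bar>) \<le> (LINT t|\<nu>. (\<bar>K.S n t \<omega>\<bar> + 1) / sqrt (real n))"
      proof (rule integral_mono)
        show "integrable \<nu> (\<lambda>t. \<bar>a n \<omega> t\<bar>)"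
          by (rule \<nu>.integrable_const_bound[of _ "sqrt (real n)"]) (auto simp: a_le)
        show "integrable \<nu> (\<lambda>t. (\<bar>K.S n t \<omega>\<bar> + 1) / sqrt (real n))"
          by (simp add: K.integrable_abs_S)
        have "inj_on (\<lambda>i. X i \<omega>) {1..n}"
          by (rule inj_on_subset[OF elim(2)]) auto
        then show "\<bar>a n \<omega> t\<bar> \<le> (\<bar>K.S n t \<omega>\<bar> + 1) / sqrt (real n)" for t
          unfolding a_def K.S_def
          by (intro abs_int_empirical_process_le_empirical_sum n F_bounds)
      qed
      also have "\<dots> = ((LINT t|\<nu>. \<bar>K.S n t \<omega>\<bar>) + 1) / sqrt (real n)"
        using \<nu>.prob_space by (simp add: K.integrable_abs_S)
      finally show "(LINT t|\<nu>. \<bar>a n \<omega> t\<bar>) \<le> ((LINT t|\<nu>. \<bar>K.S n t \<omega>\<bar>) + 1) / sqrt (real n)" .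
    qed
    have "\<forall>\<^sub>F n in sequentially.
        norm \<bar>int_KS_stat X F0 n \<omega> - (SUP t. \<bar>F t * BB n (F t) \<omega>\<bar>)\<bar>
          \<le> c * norm (ln (real n) / sqrt (real n))"
      using elim(1) eventually_ge_at_top[of 1]
    proof eventually_elim
      case (elim n)
      then show ?case
        using KS[of n] by simp
    qed
    moreover have "\<forall>\<^sub>F n in sequentially.
        norm \<bar>int_CvM_stat X F0 n \<omega> - (LINT t|interval_measure F0. (F t * BB n (F t) \<omega>)\<^sup>2)\<bar>
          \<le> (9 * c) * norm (sqrt (ln (ln (real n)) / real n) * ln (real n))"
    proof -
      have ln_ln: "\<forall>\<^sub>F n in sequentially. ln (ln (real n)) \<ge> 1"
        by real_asymp
      \<comment> \<open>The lower-order part of 2 int |a| + D_n: twice the correction 1 / sqrt n,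
        plus the bound on D_n itself. It is eventually below 1, hence below s = sqrt(ln ln
        n).\<close>
      have "(\<lambda>n. 2 / sqrt (real n) + c * (ln (real n) / sqrt (real n))) \<longlonglongrightarrow> 0"
        using \<open>c > 0\<close> by real_asymp
      then have "\<forall>\<^sub>F n in sequentially. 2 / sqrt (real n) + c * (ln (real n) / sqrt (real n)) < 1"
        by (rule order_tendstoD) simp
      with elim(1,3) ln_ln eventually_ge_at_top[of 1] show ?thesis
      proof eventually_elim
        case (elim n)
        define s where "s = sqrt (ln (ln (real n)))"
        define d where "d = c * (ln (real n) / sqrt (real n))"
        have s: "s \<ge> 1"
          using elim(3) by (simp add: s_def)
        have D0: "0 \<le> D n \<omega>"
          using D_upper[of n 0] elim(4) by linarith
        have Dd: "D n \<omega> \<le> d"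
          using elim(1) by (simp add: d_def)
        have "(LINT t|\<nu>. \<bar>a n \<omega> t\<bar>) \<le> (4 * sqrt (real n * ln (ln (real n))) + 1) / sqrt (real n)"
          using elim(2) by (intro order_trans[OF a_integral[OF elim(4)]] divide_right_mono) auto
        also have "\<dots> = 4 * s + 1 / sqrt (real n)"
          using elim(4) by (simp add: s_def real_sqrt_mult add_divide_distrib)
        finally have "2 * (LINT t|\<nu>. \<bar>a n \<omega> t\<bar>) + D n \<omega> \<le> 8 * s + (2 / sqrt (real n) + d)"
          using Dd by simp
        \<comment> \<open>The 9 consists of 8 from twice the iterated logarithm constant 4, and 1
          for the lower-order part.\<close>
        also have "\<dots> \<le> 9 * s"
          using s elim(5) by (simp add: d_def)
        finally have "D n \<omega> * (2 * (LINT t|\<nu>. \<bar>a n \<omega> t\<bar>) + D n \<omega>) \<le> d * (9 * s)"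
          using D0 Dd by (intro mult_mono) auto
        also have "\<dots> = (9 * c) * (sqrt (ln (ln (real n)) / real n) * ln (real n))"
          by (simp add: d_def s_def real_sqrt_divide)
        also have "\<dots> \<le> (9 * c) * norm (sqrt (ln (ln (real n)) / real n) * ln (real n))"
          using \<open>c > 0\<close> by (intro mult_left_mono) (auto simp only: real_norm_def abs_ge_self)
        finally show ?case
          using CvM[OF elim(4)] by simp
      qed
    qed
    ultimately show ?case
      by (blast intro: bigoI)
  qed
qed

end
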